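(* Let $p$ be a prime and let $h,m,n$ be positive integers with $m\ge n$. Then for every $s\in\mathbb{Z}_p$, \[ \operatorname{ord}_p\!\left(p^m\,\Delta_h^n\binom{s}{m}\right)\ \ge\ n\,(1+\operatorname{ord}_p h). \]
   Context: For a function $f:\mathbb{Z}_p\to\mathbb{Z}_p$ and integers $n\ge0$, $h\ge1$, the forward difference operator with increment $h$ is $\Delta_h^n f(s)=\sum_{\nu=0}^n\binom{n}{\nu}(-1)^{n-\nu}f(s+\nu h)$. Here $\binom{s}{m}=s(s-1)\cdots(s-m+1)/m!$ is the binomial polynomial, a function $\mathbb{Z}_p\to\mathbb{Z}_p$, and $\operatorname{ord}_p$ is the $p$-adic valuation. *)

theory Defs
  imports
    "HOL-Algebra.Ring"
    "HOL-Algebra.Divisibility"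
    "HOL-Computational_Algebra.Primes"
    "HOL-Library.Extended_Nat"
begin

text \<open>
  The ring of \<open>p\<close>-adic integers as the inverse limit of the rings of integers modulo
  \<open>p ^ k\<close>: a \<open>p\<close>-adic integer is the sequence of its residues, with \<open>x k\<close> the
  representative of the residue modulo \<open>p ^ k\<close> in \<open>{0..<p ^ k}\<close>.
\<close>

definition padic_int :: "nat \<Rightarrow> (nat \<Rightarrow> int) ring" where
  "padic_int p = \<lparr>
     carrier = {x. \<forall>k. 0 \<le> x k \<and> x k < int p ^ k \<and> x (Suc k) mod int p ^ k = x k},
     monoid.mult = (\<lambda>x y k. x k * y k mod int p ^ k),
     monoid.one = (\<lambda>k. 1 mod int p ^ k),
     ring.zero = (\<lambda>k. 0),
     ring.add = (\<lambda>x y k. (x k + y k) mod int p ^ k)\<rparr>"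

definition padic_of_nat :: "nat \<Rightarrow> nat \<Rightarrow> (nat \<Rightarrow> int)" where
  "padic_of_nat p n = [n] \<cdot>\<^bsub>padic_int p\<^esub> \<one>\<^bsub>padic_int p\<^esub>"

definition padic_ord :: "nat \<Rightarrow> (nat \<Rightarrow> int) \<Rightarrow> enat" where
  "padic_ord p x =
     (if x = \<zero>\<^bsub>padic_int p\<^esub> then \<infinity>
      else enat (GREATEST k. padic_of_nat p (p ^ k) divides\<^bsub>padic_int p\<^esub> x))"

text \<open>
  The quotient \<open>s (s - 1) \<dots> (s - m + 1) / m!\<close> is not formed in a field of fractions but as the
  solution \<open>y\<close> in the \<open>p\<close>-adic integers of \<open>m! y = s (s - 1) \<dots> (s - m + 1)\<close>. For
  prime \<open>p\<close> it exists and is unique, see \<open>padic_binomial_ex1\<close> below.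
\<close>

definition padic_falling :: "nat \<Rightarrow> (nat \<Rightarrow> int) \<Rightarrow> nat \<Rightarrow> (nat \<Rightarrow> int)" where
  "padic_falling p s m =
     (\<Otimes>\<^bsub>padic_int p\<^esub> i \<in> {..<m}. s \<ominus>\<^bsub>padic_int p\<^esub> padic_of_nat p i)"

definition padic_binomial :: "nat \<Rightarrow> (nat \<Rightarrow> int) \<Rightarrow> nat \<Rightarrow> (nat \<Rightarrow> int)" where
  "padic_binomial p s m =
     (THE y. y \<in> carrier (padic_int p) \<and>
             padic_of_nat p (fact m) \<otimes>\<^bsub>padic_int p\<^esub> y = padic_falling p s m)"

definition padic_diff ::
    "nat \<Rightarrow> nat \<Rightarrow> nat \<Rightarrow> ((nat \<Rightarrow> int) \<Rightarrow> (nat \<Rightarrow> int)) \<Rightarrow> (nat \<Rightarrow> int) \<Rightarrow> (nat \<Rightarrow> int)" where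
  "padic_diff p h n f s =
     (\<Oplus>\<^bsub>padic_int p\<^esub> \<nu> \<in> {..n}.
        [(int (n choose \<nu>) * (- 1) ^ (n - \<nu>))] \<cdot>\<^bsub>padic_int p\<^esub>
          f (s \<oplus>\<^bsub>padic_int p\<^esub> padic_of_nat p (\<nu> * h)))"

lemma carrier_padic_int_iff:
  "x \<in> carrier (padic_int p) \<longleftrightarrow>
     (\<forall>k. 0 \<le> x k \<and> x k < int p ^ k \<and> x (Suc k) mod int p ^ k = x k)"
  by (simp add: padic_int_def)

lemma padic_int_simps:
  "x \<otimes>\<^bsub>padic_int p\<^esub> y = (\<lambda>k. x k * y k mod int p ^ k)"
  "x \<oplus>\<^bsub>padic_int p\<^esub> y = (\<lambda>k. (x k + y k) mod int p ^ k)"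
  "\<one>\<^bsub>padic_int p\<^esub> = (\<lambda>k. 1 mod int p ^ k)"
  "\<zero>\<^bsub>padic_int p\<^esub> = (\<lambda>k. 0)"
  by (simp_all add: padic_int_def)

lemma padic_mod_self:
  assumes "x \<in> carrier (padic_int p)"
  shows "x k mod int p ^ k = x k"
  using assms by (simp add: carrier_padic_int_iff)

lemma padic_mod_add:
  assumes "x \<in> carrier (padic_int p)"
  shows "x (k + a) mod int p ^ k = x k"
proof (induction a)
  case 0
  then show ?case using padic_mod_self[OF assms] by simp
next
  case (Suc a)
  have "x (k + Suc a) mod int p ^ k = x (k + Suc a) mod int p ^ (k + a) mod int p ^ k"
    by (simp add: mod_mod_cancel power_add)
  also have "x (k + Suc a) mod int p ^ (k + a) = x (k + a)"
    using assms by (simp add: carrier_padic_int_iff)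
  finally show ?case using Suc by simp
qed

lemma padic_carrierI:
  assumes "p > 0" and "\<And>k. x k = g k mod int p ^ k"
    and "\<And>k. g (Suc k) mod int p ^ k = g k mod int p ^ k"
  shows "x \<in> carrier (padic_int p)"
proof -
  have "x (Suc k) mod int p ^ k = x k" for k
    by (simp add: assms(2) assms(3)[symmetric] mod_mod_cancel del: power_Suc)
       (metis assms(3) le_imp_power_dvd lessI less_imp_le_nat mod_mod_cancel)
  then show ?thesis
    using assms(1,2) by (simp add: carrier_padic_int_iff)
qed

lemma padic_int_cring:
  assumes "p > 0"
  shows "cring (padic_int p)"
proof (rule cringI)
  note red = carrier_padic_int_iff
  have stepD: "x (Suc k) mod int p ^ k = x k mod int p ^ k"
    if "x \<in> carrier (padic_int p)" for x k
    using that padic_mod_self[OF that, of k] by (simp add: red)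
  have add_closed: "x \<oplus>\<^bsub>padic_int p\<^esub> y \<in> carrier (padic_int p)"
    if "x \<in> carrier (padic_int p)" "y \<in> carrier (padic_int p)" for x y
    by (rule padic_carrierI[where g = "\<lambda>k. x k + y k", OF assms])
       (simp_all add: padic_int_simps mod_add_cong[OF stepD[OF that(1)] stepD[OF that(2)]])
  have mult_closed: "x \<otimes>\<^bsub>padic_int p\<^esub> y \<in> carrier (padic_int p)"
    if "x \<in> carrier (padic_int p)" "y \<in> carrier (padic_int p)" for x y
    by (rule padic_carrierI[where g = "\<lambda>k. x k * y k", OF assms])
       (simp_all add: padic_int_simps mod_mult_cong[OF stepD[OF that(1)] stepD[OF that(2)]])
  have one_closed: "\<one>\<^bsub>padic_int p\<^esub> \<in> carrier (padic_int p)"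
    by (rule padic_carrierI[where g = "\<lambda>k. 1", OF assms]) (simp_all add: padic_int_simps)
  have zero_closed: "\<zero>\<^bsub>padic_int p\<^esub> \<in> carrier (padic_int p)"
    by (rule padic_carrierI[where g = "\<lambda>k. 0", OF assms]) (simp_all add: padic_int_simps)
  have neg_ex: "\<exists>y \<in> carrier (padic_int p). y \<oplus>\<^bsub>padic_int p\<^esub> x = \<zero>\<^bsub>padic_int p\<^esub>"
    if "x \<in> carrier (padic_int p)" for x
  proof
    show "(\<lambda>k. (- x k) mod int p ^ k) \<in> carrier (padic_int p)"
      by (rule padic_carrierI[where g = "\<lambda>k. - x k", OF assms])
         (simp_all add: mod_minus_cong[OF stepD[OF that]])
    show "(\<lambda>k. (- x k) mod int p ^ k) \<oplus>\<^bsub>padic_int p\<^esub> x = \<zero>\<^bsub>padic_int p\<^esub>"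
      by (simp add: padic_int_simps mod_add_left_eq)
  qed
  show "abelian_group (padic_int p)"
  proof (rule abelian_groupI)
    fix x y z
    assume "x \<in> carrier (padic_int p)" "y \<in> carrier (padic_int p)" "z \<in> carrier (padic_int p)"
    show "x \<oplus>\<^bsub>padic_int p\<^esub> y \<oplus>\<^bsub>padic_int p\<^esub> z = x \<oplus>\<^bsub>padic_int p\<^esub> (y \<oplus>\<^bsub>padic_int p\<^esub> z)"
      by (simp add: padic_int_simps mod_add_left_eq mod_add_right_eq add.assoc)
  next
    fix x y
    show "x \<oplus>\<^bsub>padic_int p\<^esub> y = y \<oplus>\<^bsub>padic_int p\<^esub> x"
      by (simp add: padic_int_simps add.commute)
  next
    fix x assume "x \<in> carrier (padic_int p)"
    then show "\<zero>\<^bsub>padic_int p\<^esub> \<oplus>\<^bsub>padic_int p\<^esub> x = x"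
      by (simp add: padic_int_simps padic_mod_self)
  qed (use add_closed zero_closed neg_ex in auto)
  show "comm_monoid (padic_int p)"
  proof (rule comm_monoidI)
    fix x y z
    assume "x \<in> carrier (padic_int p)" "y \<in> carrier (padic_int p)" "z \<in> carrier (padic_int p)"
    show "x \<otimes>\<^bsub>padic_int p\<^esub> y \<otimes>\<^bsub>padic_int p\<^esub> z = x \<otimes>\<^bsub>padic_int p\<^esub> (y \<otimes>\<^bsub>padic_int p\<^esub> z)"
      by (simp add: padic_int_simps mod_mult_left_eq mod_mult_right_eq mult.assoc)
  next
    fix x y
    show "x \<otimes>\<^bsub>padic_int p\<^esub> y = y \<otimes>\<^bsub>padic_int p\<^esub> x"
      by (simp add: padic_int_simps mult.commute)
  next
    fix x assume "x \<in> carrier (padic_int p)"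
    then show "\<one>\<^bsub>padic_int p\<^esub> \<otimes>\<^bsub>padic_int p\<^esub> x = x"
      by (simp add: padic_int_simps padic_mod_self mod_mult_left_eq)
  qed (use mult_closed one_closed in auto)
  fix x y z
  show "(x \<oplus>\<^bsub>padic_int p\<^esub> y) \<otimes>\<^bsub>padic_int p\<^esub> z =
        x \<otimes>\<^bsub>padic_int p\<^esub> z \<oplus>\<^bsub>padic_int p\<^esub> y \<otimes>\<^bsub>padic_int p\<^esub> z"
    by (simp add: padic_int_simps mod_mult_left_eq mod_add_left_eq mod_add_right_eq distrib_right)
qed

lemma padic_of_nat_apply:
  assumes "p > 0"
  shows "padic_of_nat p n = (\<lambda>k. int n mod int p ^ k)"
proof -
  interpret cring "padic_int p" by (rule padic_int_cring[OF assms])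
  show ?thesis
  proof (induction n)
    case 0
    show ?case by (simp add: padic_of_nat_def) (simp add: padic_int_simps)
  next
    case (Suc n)
    have "padic_of_nat p (Suc n) = padic_of_nat p n \<oplus>\<^bsub>padic_int p\<^esub> \<one>\<^bsub>padic_int p\<^esub>"
      by (simp add: padic_of_nat_def add.nat_pow_Suc)
    then show ?case
      by (simp add: Suc padic_int_simps mod_add_eq add.commute)
  qed
qed

lemma padic_of_nat_closed:
  assumes "p > 0"
  shows "padic_of_nat p n \<in> carrier (padic_int p)"
proof -
  interpret cring "padic_int p" by (rule padic_int_cring[OF assms])
  show ?thesis by (simp add: padic_of_nat_def)
qed

lemma padic_a_inv_apply:
  assumes "p > 0" and "x \<in> carrier (padic_int p)"
  shows "\<ominus>\<^bsub>padic_int p\<^esub> x = (\<lambda>k. (- x k) mod int p ^ k)"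
proof -
  interpret cring "padic_int p" by (rule padic_int_cring[OF assms(1)])
  have "(\<lambda>k. (- x k) mod int p ^ k) \<in> carrier (padic_int p)"
  proof (rule padic_carrierI[where g = "\<lambda>k. - x k", OF assms(1)])
    fix k
    have "x (Suc k) mod int p ^ k = x k mod int p ^ k"
      using assms(2) padic_mod_self[OF assms(2), of k] by (simp add: carrier_padic_int_iff)
    then show "(- x (Suc k)) mod int p ^ k = (- x k) mod int p ^ k"
      by (rule mod_minus_cong)
  qed simp
  moreover have "(\<lambda>k. (- x k) mod int p ^ k) \<oplus>\<^bsub>padic_int p\<^esub> x = \<zero>\<^bsub>padic_int p\<^esub>"
    by (simp add: padic_int_simps mod_add_left_eq)
  ultimately show ?thesis
    using minus_equality assms(2) by blast
qed

lemma padic_falling_apply: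
  assumes "p > 0" and "s \<in> carrier (padic_int p)"
  shows "padic_falling p s m = (\<lambda>k. (\<Prod>i<m. s k - int i) mod int p ^ k)"
    and "padic_falling p s m \<in> carrier (padic_int p)"
proof -
  interpret cring "padic_int p" by (rule padic_int_cring[OF assms(1)])
  have cl: "s \<ominus>\<^bsub>padic_int p\<^esub> padic_of_nat p i \<in> carrier (padic_int p)" for i
    using assms padic_of_nat_closed by auto
  have diff: "s \<ominus>\<^bsub>padic_int p\<^esub> padic_of_nat p i = (\<lambda>k. (s k - int i) mod int p ^ k)" for i
    by (simp add: a_minus_def padic_a_inv_apply[OF assms(1) padic_of_nat_closed[OF assms(1)]])
       (simp add: padic_int_simps padic_of_nat_apply[OF assms(1)] mod_simps)
  show "padic_falling p s m = (\<lambda>k. (\<Prod>i<m. s k - int i) mod int p ^ k)"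
  proof (induction m)
    case 0
    show ?case by (simp add: padic_falling_def padic_int_simps)
  next
    case (Suc m)
    have "padic_falling p s (Suc m) =
        (s \<ominus>\<^bsub>padic_int p\<^esub> padic_of_nat p m) \<otimes>\<^bsub>padic_int p\<^esub> padic_falling p s m"
      unfolding padic_falling_def lessThan_Suc by (rule finprod_insert) (use cl in auto)
    then show ?case
      by (simp add: Suc diff padic_int_simps mod_mult_eq mult.commute)
  qed
  show "padic_falling p s m \<in> carrier (padic_int p)"
    unfolding padic_falling_def by (rule finprod_closed) (use cl in auto)
qed

lemma padic_of_nat_mult_cancel:
  assumes "Factorial_Ring.prime p" and "n > 0"
    and "x \<in> carrier (padic_int p)" and "y \<in> carrier (padic_int p)"
    and eq: "padic_of_nat p n \<otimes>\<^bsub>padic_int p\<^esub> x = padic_of_nat p n \<otimes>\<^bsub>padic_int p\<^esub> y"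
  shows "x = y"
proof
  fix k
  have p0: "p > 0" using assms(1) by (simp add: prime_gt_0_nat)
  define a where "a = multiplicity p n"
  obtain u where u: "n = p ^ a * u" "\<not> p dvd u"
    using multiplicity_decompose'[of n p] assms(1,2) unfolding a_def
    by (metis not_prime_unit not_gr_zero)
  have "int n * x (k + a) mod int p ^ (k + a) = int n * y (k + a) mod int p ^ (k + a)"
    using fun_cong[OF eq, of "k + a"] by (simp add: padic_int_simps padic_of_nat_apply[OF p0] mod_simps)
  then have "int p ^ (k + a) dvd int n * (x (k + a) - y (k + a))"
    by (simp add: mod_eq_dvd_iff algebra_simps)
  then have "int p ^ a * int p ^ k dvd int p ^ a * (int u * (x (k + a) - y (k + a)))"
    by (simp add: u(1) power_add mult_ac)
  then have "int p ^ k dvd int u * (x (k + a) - y (k + a))"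
    using p0 by simp
  moreover have "coprime (int p ^ k) (int u)"
    using u(2) assms(1) by (simp add: prime_imp_coprime)
  ultimately have "int p ^ k dvd x (k + a) - y (k + a)"
    by (simp add: coprime_dvd_mult_right_iff)
  then have "x (k + a) mod int p ^ k = y (k + a) mod int p ^ k"
    by (simp add: mod_eq_dvd_iff)
  then show "x k = y k"
    using padic_mod_add assms(3,4) by simp
qed

lemma padic_binomial_ex1:
  assumes "Factorial_Ring.prime p" and s: "s \<in> carrier (padic_int p)"
  shows "\<exists>!y. y \<in> carrier (padic_int p) \<and>
           padic_of_nat p (fact m) \<otimes>\<^bsub>padic_int p\<^esub> y = padic_falling p s m"
proof (rule ex_ex1I)
  have p0: "p > 0" using assms(1) by (simp add: prime_gt_0_nat)
  define a where "a = multiplicity p (fact m :: nat)"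
  obtain u where u: "(fact m :: nat) = p ^ a * u" "\<not> p dvd u"
    using multiplicity_decompose'[of "fact m :: nat" p] assms(1) unfolding a_def
    by (metis not_prime_unit fact_nonzero)
  define c where "c k = int (nat (s (k + a)) choose m)" for k
  have fall: "fact m * int (x choose m) = (\<Prod>i<m. int x - int i)" for x
  proof -
    have "real_of_int (fact m * int (x choose m)) = fact m * (of_nat x gchoose m)"
      by (simp add: binomial_gbinomial)
    also have "\<dots> = real_of_int (\<Prod>i<m. int x - int i)"
      by (simp add: gbinomial_prod_rev atLeast0LessThan)
    finally show ?thesis by (simp only: of_int_eq_iff)
  qed
  have s_nonneg: "s k \<ge> 0" for k using s by (simp add: carrier_padic_int_iff)
  have c: "fact m * c k = (\<Prod>i<m. s (k + a) - int i)" for k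
    using fall[of "nat (s (k + a))"] s_nonneg[of "k + a"] by (simp add: c_def)
  have prod_cong: "(\<Prod>i<m. x - int i) mod q = (\<Prod>i<m. y - int i) mod q"
    if "x mod q = y mod q" for x y q :: int
  proof -
    have "(\<Prod>i<m. (x - int i) mod q) mod q = (\<Prod>i<m. (y - int i) mod q) mod q"
      by (intro arg_cong[where f = "\<lambda>z. z mod q"] prod.cong mod_diff_cong that refl)
    then show ?thesis by (simp add: mod_prod_eq)
  qed
  have step: "c (Suc k) mod int p ^ k = c k mod int p ^ k" for k
  proof -
    have "s (Suc k + a) mod int p ^ (k + a) = s (k + a) mod int p ^ (k + a)"
      using s padic_mod_self[OF s, of "k + a"] by (simp add: carrier_padic_int_iff)
    then have "fact m * c (Suc k) mod int p ^ (k + a) = fact m * c k mod int p ^ (k + a)"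
      unfolding c by (rule prod_cong)
    then have "int p ^ (k + a) dvd int (fact m) * (c (Suc k) - c k)"
      by (simp add: mod_eq_dvd_iff algebra_simps)
    then have "int p ^ a * int p ^ k dvd int p ^ a * (int u * (c (Suc k) - c k))"
      unfolding u(1) by (simp add: power_add mult_ac)
    then have "int p ^ k dvd int u * (c (Suc k) - c k)"
      using p0 by simp
    moreover have "coprime (int p ^ k) (int u)"
      using u(2) assms(1) by (simp add: prime_imp_coprime)
    ultimately show ?thesis
      by (simp add: coprime_dvd_mult_right_iff mod_eq_dvd_iff)
  qed
  show "\<exists>y. y \<in> carrier (padic_int p) \<and>
          padic_of_nat p (fact m) \<otimes>\<^bsub>padic_int p\<^esub> y = padic_falling p s m"
  proof (intro exI conjI)
    show "(\<lambda>k. c k mod int p ^ k) \<in> carrier (padic_int p)"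
      by (rule padic_carrierI[where g = c, OF p0]) (simp_all add: step)
    have "fact m * c k mod int p ^ k = (\<Prod>i<m. s k - int i) mod int p ^ k" for k
      unfolding c by (rule prod_cong) (simp add: padic_mod_add[OF s] padic_mod_self[OF s])
    then show "padic_of_nat p (fact m) \<otimes>\<^bsub>padic_int p\<^esub> (\<lambda>k. c k mod int p ^ k) =
        padic_falling p s m"
      by (simp add: padic_falling_apply[OF p0 s] padic_int_simps padic_of_nat_apply[OF p0] mod_simps)
  qed
next
  fix y z
  assume "y \<in> carrier (padic_int p) \<and>
      padic_of_nat p (fact m) \<otimes>\<^bsub>padic_int p\<^esub> y = padic_falling p s m"
    and "z \<in> carrier (padic_int p) \<and>
      padic_of_nat p (fact m) \<otimes>\<^bsub>padic_int p\<^esub> z = padic_falling p s m"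
  then show "y = z"
    using padic_of_nat_mult_cancel[OF assms(1), of "fact m" y z] by simp
qed

lemma padic_of_nat_power_divides_iff:
  assumes "p > 0" and x: "x \<in> carrier (padic_int p)"
  shows "padic_of_nat p (p ^ k) divides\<^bsub>padic_int p\<^esub> x \<longleftrightarrow> x k = 0"
proof
  assume "padic_of_nat p (p ^ k) divides\<^bsub>padic_int p\<^esub> x"
  then show "x k = 0"
    by (auto simp: factor_def padic_int_simps padic_of_nat_apply[OF assms(1)])
next
  assume xk: "x k = 0"
  define c where "c j = x (j + k) div int p ^ k" for j
  have dvd: "int p ^ k dvd x (j + k)" for j
    using padic_mod_add[OF x, of k j] xk by (simp add: add.commute mod_eq_0_iff_dvd)
  have xc: "x (j + k) = int p ^ k * c j" for j
    using dvd[of j] by (simp add: c_def)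
  have "(\<lambda>j. c j mod int p ^ j) \<in> carrier (padic_int p)"
  proof (rule padic_carrierI[where g = c, OF assms(1)])
    fix j
    have "x (Suc j + k) mod int p ^ (j + k) = x (j + k) mod int p ^ (j + k)"
      using x padic_mod_self[OF x, of "j + k"] by (simp add: carrier_padic_int_iff)
    then have "int p ^ k * int p ^ j dvd int p ^ k * (c (Suc j) - c j)"
      unfolding xc mod_eq_dvd_iff right_diff_distrib power_add
      by (simp only: mult.commute[of "int p ^ j"])
    then show "c (Suc j) mod int p ^ j = c j mod int p ^ j"
      using assms(1) by (simp add: mod_eq_dvd_iff)
  qed simp
  moreover have "x = padic_of_nat p (p ^ k) \<otimes>\<^bsub>padic_int p\<^esub> (\<lambda>j. c j mod int p ^ j)"
  proof
    fix j
    have "x j = x (j + k) mod int p ^ j"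
      using padic_mod_add[OF x] by simp
    then show "x j = (padic_of_nat p (p ^ k) \<otimes>\<^bsub>padic_int p\<^esub> (\<lambda>j. c j mod int p ^ j)) j"
      by (simp add: xc padic_int_simps padic_of_nat_apply[OF assms(1)] mod_simps)
  qed
  ultimately show "padic_of_nat p (p ^ k) divides\<^bsub>padic_int p\<^esub> x"
    by (auto simp: factor_def)
qed

lemma padic_ord_ge_iff:
  assumes "p > 0" and x: "x \<in> carrier (padic_int p)"
  shows "enat k \<le> padic_ord p x \<longleftrightarrow> padic_of_nat p (p ^ k) divides\<^bsub>padic_int p\<^esub> x"
proof (cases "x = \<zero>\<^bsub>padic_int p\<^esub>")
  case True
  then show ?thesis
    by (simp add: padic_ord_def padic_of_nat_power_divides_iff[OF assms(1)] x[unfolded True])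
       (simp add: padic_int_simps)
next
  case False
  then obtain b where b: "x b \<noteq> 0"
    by (auto simp: padic_int_simps fun_eq_iff)
  have down: "x i = 0" if "x j = 0" "i \<le> j" for i j
    using padic_mod_add[OF x, of i "j - i"] that by simp
  then have bound: "j \<le> b" if "x j = 0" for j
    using that b by (meson nat_le_linear)
  have x0: "x 0 = 0"
    using x by (auto simp: carrier_padic_int_iff dest!: spec[of _ 0])
  define g where "g = (GREATEST j. x j = 0)"
  have "x g = 0"
    unfolding g_def by (rule GreatestI_nat[of "\<lambda>j. x j = 0", OF x0 bound])
  moreover have "j \<le> g" if "x j = 0" for j
    unfolding g_def by (rule Greatest_le_nat[of "\<lambda>j. x j = 0", OF that bound])
  ultimately have "k \<le> g \<longleftrightarrow> x k = 0"
    using down by blast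
  then show ?thesis
    using False by (simp add: padic_ord_def padic_of_nat_power_divides_iff[OF assms] g_def)
qed

end

theory Submission
  imports Defs "HOL-Computational_Algebra.Polynomial" "HOL-Number_Theory.Cong"
begin

text \<open>
  Up to the precision needed, \<open>s\<close> may be replaced by a natural number \<open>x\<close>. There, \<open>p ^ m\<close> times the
  difference is the coefficient of \<open>X ^ m\<close> in \<open>(1 + p X) ^ x * ((1 + p X) ^ h - 1) ^ n\<close>. If
  \<open>p ^ a\<close> divides \<open>h\<close>, then \<open>p ^ (a + 1)\<close> divides all coefficients of \<open>(1 + p X) ^ h - 1\<close>.
\<close>

text \<open>Lifting the exponent: raising to the \<open>p\<close>-th power gains a factor
  \<open>p\<close>, because \<open>z ^ p - 1 = (z - 1) * (\<Sum>i<p. z ^ i)\<close> and the sum is a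
  multiple of \<open>p\<close> as soon as \<open>z\<close> is 1 modulo \<open>p\<close>. The ring is
  general so that \<open>y\<close> can be a polynomial.\<close>

lemma of_nat_dvd_power_diff_one:
  fixes y :: "'a::comm_ring_1"
  assumes "of_nat p dvd y - 1" and "p ^ a dvd h"
  shows "of_nat (p ^ Suc a) dvd y ^ h - 1"
proof -
  have base: "of_nat (p ^ Suc a) dvd y ^ (p ^ a) - 1" for a
  proof (induction a)
    case 0
    then show ?case using assms(1) by simp
  next
    case (Suc a)
    define z where "z = y ^ (p ^ a)"
    have pz: "of_nat p dvd z - 1"
      using Suc by (auto simp: z_def intro: dvd_mult_left)
    \<comment> \<open>All powers of \<open>z\<close> are 1 modulo \<open>p\<close>, so the sum of
      \<open>p\<close> of them is congruent to \<open>p\<close>, hence to 0.\<close>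
    have "z - 1 dvd z ^ i - 1" for i
      by (simp add: power_diff_1_eq)
    then have "of_nat p dvd (\<Sum>i<p. z ^ i - 1)"
      using pz by (meson dvd_sum dvd_trans)
    then have "of_nat p dvd (\<Sum>i<p. z ^ i) - of_nat p"
      by (simp add: sum_subtractf)
    then have "of_nat p dvd (\<Sum>i<p. z ^ i)"
      by (metis dvd_diff_right_iff dvd_refl dvd_add_right_iff diff_add_cancel dvd_add)
    \<comment> \<open>The induction hypothesis handles the factor \<open>z - 1\<close>; the
      geometric sum supplies the additional \<open>p\<close>.\<close>
    then have "of_nat (p ^ Suc a) * of_nat p dvd (z - 1) * (\<Sum>i<p. z ^ i)"
      using Suc unfolding z_def by (rule mult_dvd_mono[rotated])
    also have "\<dots> = y ^ (p ^ Suc a) - 1"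
      using power_diff_1_eq[of z p] by (simp add: z_def mult.commute flip: power_mult)
    finally show ?case by (simp add: mult_ac)
  qed
  obtain u where "h = p ^ a * u" using assms(2) by blast
  then have "y ^ (p ^ a) - 1 dvd y ^ h - 1"
    by (simp add: power_mult power_diff_1_eq)
  then show ?thesis using base dvd_trans by blast
qed

text \<open>Pascal's rule: multiplication by \<open>[:1, c:]\<close> adds to each coefficient
  \<open>c\<close> times the preceding one.\<close>

lemma coeff_one_plus_monom_power:
  fixes c :: "'a::comm_semiring_1"
  shows "coeff ([:1, c:] ^ y) m = of_nat (y choose m) * c ^ m"
proof (induction y arbitrary: m)
  case 0
  then show ?case by (cases m) auto
next
  case (Suc y)
  then show ?case by (cases m) (auto simp: algebra_simps)
qed

lemma dvd_difference_binomial: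
  fixes p h m n x a :: nat
  assumes "p ^ a dvd h"
  shows "int p ^ (n * Suc a) dvd
    int p ^ m * (\<Sum>\<nu>\<le>n. int (n choose \<nu>) * (- 1) ^ (n - \<nu>) * int ((x + \<nu> * h) choose m))"
proof -
  define f :: "int poly" where "f = [:1, int p:]"
  have "of_nat p dvd f - 1"
  proof
    show "f - 1 = of_nat p * [:0, 1:]"
      by (simp add: f_def of_nat_poly one_pCons)
  qed
  then have "of_nat (p ^ Suc a) dvd f ^ h - 1"
    using assms by (rule of_nat_dvd_power_diff_one)
  then have "of_nat (p ^ Suc a) ^ n dvd (f ^ h - 1) ^ n"
    by (rule dvd_power_same)
  \<comment> \<open>Divisibility by a constant polynomial can be read off coefficient by
    coefficient.\<close>
  then have "[:int p ^ (n * Suc a):] dvd f ^ x * (f ^ h - 1) ^ n"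
    by (simp add: of_nat_poly dvd_mult poly_const_pow flip: power_mult power_Suc)
       (metis dvd_mult mult.commute)
  then have "int p ^ (n * Suc a) dvd coeff (f ^ x * (f ^ h - 1) ^ n) m"
    by (simp add: const_poly_dvd_iff)
  \<comment> \<open>Expanding \<open>(f ^ h + (- 1)) ^ n\<close> produces the signs of the
    difference operator, and \<open>f ^ x\<close> moves its base point to \<open>x\<close>.\<close>
  also have "f ^ x * (f ^ h - 1) ^ n =
      (\<Sum>\<nu>\<le>n. of_int (int (n choose \<nu>) * (- 1) ^ (n - \<nu>)) * f ^ (x + \<nu> * h))"
    unfolding diff_conv_add_uminus binomial_ring sum_distrib_left
    by (simp add: power_add mult_ac flip: power_mult)
  also have "coeff \<dots> m = int p ^ m *
      (\<Sum>\<nu>\<le>n. int (n choose \<nu>) * (- 1) ^ (n - \<nu>) * int ((x + \<nu> * h) choose m))"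
    by (simp add: coeff_sum of_int_poly f_def coeff_one_plus_monom_power sum_distrib_left mult_ac
        del: of_int_mult of_int_power)
  finally show ?thesis .
qed

text \<open>Taking the component at \<open>k\<close> is a ring homomorphism to the integers modulo
  \<open>p ^ k\<close>, which turns sums of \<open>p\<close>-adic integers into integer
  sums.\<close>

lemma padic_finsum_apply:
  assumes "p > 0" and "finite A" and "\<And>i. i \<in> A \<Longrightarrow> f i \<in> carrier (padic_int p)"
  shows "(\<Oplus>\<^bsub>padic_int p\<^esub> i \<in> A. f i) k = (\<Sum>i\<in>A. f i k) mod int p ^ k"
proof -
  interpret cring "padic_int p" by (rule padic_int_cring[OF assms(1)])
  show ?thesis
    using assms(2,3)
  proof (induction A rule: finite_induct)
    case empty
    then show ?case by (simp) (simp add: padic_int_simps)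
  next
    case (insert i A)
    then have "(\<Oplus>\<^bsub>padic_int p\<^esub> i \<in> insert i A. f i) =
      f i \<oplus>\<^bsub>padic_int p\<^esub> (\<Oplus>\<^bsub>padic_int p\<^esub> i \<in> A. f i)"
      by (intro finsum_insert) auto
    with insert show ?case
      by (simp add: padic_int_simps mod_simps)
  qed
qed

lemma padic_int_scale_apply:
  assumes "p > 0" and x: "x \<in> carrier (padic_int p)"
  shows "([z] \<cdot>\<^bsub>padic_int p\<^esub> x) k = z * x k mod int p ^ k"
proof -
  interpret cring "padic_int p" by (rule padic_int_cring[OF assms(1)])
  have nat: "([n] \<cdot>\<^bsub>padic_int p\<^esub> x) k = int n * x k mod int p ^ k" for n :: nat
  proof (induction n)
    case 0
    show ?case by simp (simp add: padic_int_simps)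
  next
    case (Suc n)
    then show ?case
      by (simp add: add.nat_pow_Suc) (simp add: padic_int_simps mod_simps algebra_simps)
  qed
  show ?thesis
  proof (cases "z \<ge> 0")
    case True
    then show ?thesis using nat[of "nat z"] by (simp add: add_pow_int_ge)
  next
    case False
    then show ?thesis
      using nat[of "nat (- z)"] x
      by (simp add: add_pow_int_lt padic_a_inv_apply[OF assms(1)] mod_simps)
  qed
qed

lemma padic_binomial_closed:
  assumes "Factorial_Ring.prime p" and "t \<in> carrier (padic_int p)"
  shows "padic_binomial p t m \<in> carrier (padic_int p)"
    and "padic_of_nat p (fact m) \<otimes>\<^bsub>padic_int p\<^esub> padic_binomial p t m = padic_falling p t m"
  using theI'[OF padic_binomial_ex1[OF assms, of m]] unfolding padic_binomial_def by auto

lemma prod_diff_eq_fact_mult_binomial: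
  "(\<Prod>i<m. int x - int i) = fact m * int (x choose m)"
proof -
  \<comment> \<open>The detour through the reals gives access to the product formula for
    \<open>gchoose\<close>, which also covers \<open>x < m\<close>, where both sides vanish.\<close>
  have "real_of_int (fact m * int (x choose m)) = fact m * (of_nat x gchoose m)"
    by (simp add: binomial_gbinomial)
  also have "\<dots> = real_of_int (\<Prod>i<m. int x - int i)"
    by (simp add: gbinomial_prod_rev atLeast0LessThan)
  finally show ?thesis by (simp only: of_int_eq_iff)
qed

text \<open>Dividing by \<open>m!\<close> costs \<open>multiplicity p (fact m)\<close> digits of precision.\<close>

lemma padic_binomial_apply:
  assumes "Factorial_Ring.prime p" and t: "t \<in> carrier (padic_int p)"
    and x: "[t (k + multiplicity p (fact m)) = int x] (mod int p ^ (k + multiplicity p (fact m)))"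
  shows "padic_binomial p t m k = int (x choose m) mod int p ^ k"
proof -
  have p0: "p > 0" using assms(1) by (simp add: prime_gt_0_nat)
  define a where "a = multiplicity p (fact m :: nat)"
  obtain u where u: "(fact m :: nat) = p ^ a * u" "\<not> p dvd u"
    using multiplicity_decompose'[of "fact m :: nat" p] assms(1) unfolding a_def
    by (metis not_prime_unit fact_nonzero)
  define y where "y = padic_binomial p t m"
  have y: "y \<in> carrier (padic_int p)"
    and yf: "padic_of_nat p (fact m) \<otimes>\<^bsub>padic_int p\<^esub> y = padic_falling p t m"
    using padic_binomial_closed[OF assms(1) t] by (simp_all add: y_def)
  have "[int (fact m) * y (k + a) = (\<Prod>i<m. t (k + a) - int i)] (mod int p ^ (k + a))"
    using fun_cong[OF yf, of "k + a"]
    by (simp add: padic_int_simps padic_of_nat_apply[OF p0] padic_falling_apply[OF p0 t]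
        cong_def mod_simps)
  also have "[(\<Prod>i<m. t (k + a) - int i) = (\<Prod>i<m. int x - int i)] (mod int p ^ (k + a))"
    using x unfolding a_def[symmetric] by (intro cong_prod cong_diff cong_refl)
  also have "(\<Prod>i<m. int x - int i) = int (fact m) * int (x choose m)"
    by (simp add: prod_diff_eq_fact_mult_binomial)
  finally have "int p ^ (k + a) dvd int (fact m) * (y (k + a) - int (x choose m))"
    by (simp add: cong_iff_dvd_diff algebra_simps)
  \<comment> \<open>Cancelling \<open>p ^ a\<close> lowers the modulus from
    \<open>p ^ (k + a)\<close> to \<open>p ^ k\<close>; the rest \<open>u\<close> of
    \<open>m!\<close> is then invertible.\<close>
  then have "int p ^ a * int p ^ k dvd int p ^ a * (int u * (y (k + a) - int (x choose m)))"
    unfolding u(1) by (simp add: power_add mult_ac)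
  then have "int p ^ k dvd int u * (y (k + a) - int (x choose m))"
    using p0 by simp
  moreover have "coprime (int p ^ k) (int u)"
    using u(2) assms(1) by (simp add: prime_imp_coprime)
  ultimately have "y (k + a) mod int p ^ k = int (x choose m) mod int p ^ k"
    by (simp add: coprime_dvd_mult_right_iff mod_eq_dvd_iff)
  then show ?thesis
    using padic_mod_add[OF y] by (simp add: y_def)
qed

text \<open>The weights of the difference operator are integers, so no precision is lost: the values
  of \<open>f\<close> are needed only at the same level \<open>k\<close>.\<close>

lemma padic_diff_apply:
  assumes "p > 0" and "s \<in> carrier (padic_int p)"
    and "\<And>t. t \<in> carrier (padic_int p) \<Longrightarrow> f t \<in> carrier (padic_int p)"
  shows "padic_diff p h n f s \<in> carrier (padic_int p)"
    and "padic_diff p h n f s k =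
      (\<Sum>\<nu>\<le>n. int (n choose \<nu>) * (- 1) ^ (n - \<nu>) *
        f (s \<oplus>\<^bsub>padic_int p\<^esub> padic_of_nat p (\<nu> * h)) k) mod int p ^ k"
proof -
  interpret cring "padic_int p" by (rule padic_int_cring[OF assms(1)])
  have cl: "f (s \<oplus>\<^bsub>padic_int p\<^esub> padic_of_nat p j) \<in> carrier (padic_int p)" for j
    using assms padic_of_nat_closed by auto
  then show "padic_diff p h n f s \<in> carrier (padic_int p)"
    unfolding padic_diff_def by (intro finsum_closed) auto
  show "padic_diff p h n f s k =
      (\<Sum>\<nu>\<le>n. int (n choose \<nu>) * (- 1) ^ (n - \<nu>) *
        f (s \<oplus>\<^bsub>padic_int p\<^esub> padic_of_nat p (\<nu> * h)) k) mod int p ^ k"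
    unfolding padic_diff_def using cl
    by (subst padic_finsum_apply) (auto simp: assms(1) padic_int_scale_apply mod_sum_eq)
qed

lemma padic_ord_of_nat:
  assumes "Factorial_Ring.prime p" and "h > 0"
  obtains a where "padic_ord p (padic_of_nat p h) = enat a" and "p ^ a dvd h"
proof -
  have p: "p > 1" using assms(1) by (rule prime_gt_1_nat)
  have iff: "enat k \<le> padic_ord p (padic_of_nat p h) \<longleftrightarrow> p ^ k dvd h" for k
    using p by (simp add: padic_ord_ge_iff padic_of_nat_closed padic_of_nat_power_divides_iff)
      (simp add: padic_of_nat_apply mod_eq_0_iff_dvd flip: of_nat_power of_nat_mod)
  \<comment> \<open>Since \<open>p ^ h > h > 0\<close>, the order is below \<open>h\<close> and in
    particular finite.\<close>
  have "\<not> p ^ h dvd h"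
    using assms(2) power_gt_expt[of p h] p by (auto dest: dvd_imp_le)
  then obtain a where "padic_ord p (padic_of_nat p h) = enat a"
    using iff[of h] by (cases "padic_ord p (padic_of_nat p h)") simp_all
  with iff[of a] that show ?thesis by simp
qed

theorem theorem2p4:
  fixes p h m n :: nat and s :: "nat \<Rightarrow> int"
  assumes "Factorial_Ring.prime p"
    and "h > 0" and "m > 0" and "n > 0" and "n \<le> m"
    and "s \<in> carrier (padic_int p)"
  shows "padic_ord p
           (padic_of_nat p (p ^ m) \<otimes>\<^bsub>padic_int p\<^esub>
              padic_diff p h n (\<lambda>t. padic_binomial p t m) s)
         \<ge> of_nat n * (1 + padic_ord p (padic_of_nat p h))"
proof -
  have p0: "p > 0" using assms(1) by (simp add: prime_gt_0_nat)
  interpret cring "padic_int p" by (rule padic_int_cring[OF p0])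
  obtain a where a: "padic_ord p (padic_of_nat p h) = enat a" "p ^ a dvd h"
    using padic_ord_of_nat assms(1,2) by blast
  \<comment> \<open>\<open>N\<close> is the exponent to be reached, \<open>K\<close> adds the digits
    lost in dividing by \<open>m!\<close>, and \<open>x\<close> is the natural number that agrees
    with \<open>s\<close> modulo \<open>p ^ K\<close>.\<close>
  define N where "N = n * Suc a"
  define K where "K = N + multiplicity p (fact m :: nat)"
  define x where "x = nat (s K)"
  let ?t = "\<lambda>\<nu>. s \<oplus>\<^bsub>padic_int p\<^esub> padic_of_nat p (\<nu> * h)"
  let ?D = "padic_diff p h n (\<lambda>t. padic_binomial p t m) s"
  let ?c = "\<lambda>\<nu>. int (n choose \<nu>) * (- 1) ^ (n - \<nu>)"
  have sK: "s K = int x"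
    using assms(6) by (simp add: x_def carrier_padic_int_iff)
  have bin: "padic_binomial p (?t \<nu>) m N = int ((x + \<nu> * h) choose m) mod int p ^ N" for \<nu>
  proof (rule padic_binomial_apply[OF assms(1)])
    show "?t \<nu> \<in> carrier (padic_int p)"
      using assms(6) padic_of_nat_closed[OF p0] by simp
    show "[?t \<nu> (N + multiplicity p (fact m)) = int (x + \<nu> * h)]
        (mod int p ^ (N + multiplicity p (fact m)))"
      unfolding K_def[symmetric]
      by (simp add: padic_int_simps padic_of_nat_apply[OF p0] sK cong_def mod_simps)
  qed
  note D = padic_diff_apply[OF p0 assms(6) padic_binomial_closed(1)[OF assms(1)]]
  have "?D N = (\<Sum>\<nu>\<le>n. ?c \<nu> * int ((x + \<nu> * h) choose m)) mod int p ^ N"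
  proof -
    have "?D N = (\<Sum>\<nu>\<le>n. ?c \<nu> * (int ((x + \<nu> * h) choose m) mod int p ^ N)) mod int p ^ N"
      by (simp add: D(2) bin)
    also have "\<dots> = (\<Sum>\<nu>\<le>n. ?c \<nu> * int ((x + \<nu> * h) choose m)) mod int p ^ N"
      by (subst (1 2) mod_sum_eq[symmetric]) (simp add: mod_mult_right_eq)
    finally show ?thesis .
  qed
  then have "(padic_of_nat p (p ^ m) \<otimes>\<^bsub>padic_int p\<^esub> ?D) N =
      int p ^ m * (\<Sum>\<nu>\<le>n. ?c \<nu> * int ((x + \<nu> * h) choose m)) mod int p ^ N"
    by (simp add: padic_int_simps padic_of_nat_apply[OF p0] mod_simps)
  also have "\<dots> = 0"
    using dvd_difference_binomial[OF a(2)] unfolding N_def by (simp only: mod_eq_0_iff_dvd)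
  \<comment> \<open>A \<open>p\<close>-adic integer is divisible by \<open>p ^ N\<close> exactly
    when its component at \<open>N\<close> vanishes.\<close>
  finally have "enat N \<le> padic_ord p (padic_of_nat p (p ^ m) \<otimes>\<^bsub>padic_int p\<^esub> ?D)"
    using p0 D(1) padic_of_nat_closed[OF p0]
    by (simp add: padic_ord_ge_iff padic_of_nat_power_divides_iff)
  moreover have "of_nat n * (1 + padic_ord p (padic_of_nat p h)) = enat N"
    by (simp add: a(1) N_def of_nat_eq_enat one_enat_def)
  ultimately show ?thesis by simp
qed

end
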